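(* For any two finite, simple, connected graphs $G$ and $H$, $\zeta(G \square H) \geq \max\{\zeta(G), \zeta(H)\}$.
   Context: All graphs are finite, simple, undirected and connected. The localization game on a graph $G$ is played by a Cop controlling $k$ cops and a Robber. The Robber first chooses a vertex $r$, unknown to the Cop. In each turn the Cop probes a set $B=\{b_1,\dots,b_k\}$ of $k$ vertices (repetitions across turns allowed) and receives the distance vector $[d_G(r,b_1),\dots,d_G(r,b_k)]$. If the Cop can determine $r$ exactly from the information received, the Cop wins; otherwise the Robber may stay at $r$ or move to a neighbour of $r$, and the next turn begins. The Cop wins if the Robber is located after finitely many turns. The localization number $\zeta(G)$ is the least positive integer $k$ such that the Cop has a winning strategy with $k$ cops against every strategy of the Robber. $G \square H$ denotes the Cartesian product: vertex set $V(G)\times V(H)$, with $(u,u')$ adjacent to $(v,v')$ iff either $u=v$ and $u'v'\in E(H)$, or $u'=v'$ and $uv\in E(G)$. *)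

theory Defs
  imports "Graph_Theory.Graph_Theory"
begin

text \<open>
  Finite simple undirected graphs are the symmetric loop-free finite digraphs of
  \<^locale>\<open>pair_graph\<close>; an edge \<open>uv\<close> is represented by the two arcs \<open>(u, v)\<close> and \<open>(v, u)\<close>.
  Connectedness is \<^const>\<open>Digraph_Component.connected\<close>, which includes non-emptiness.
\<close>

definition cartesian_product ::
    "'a pair_pre_digraph \<Rightarrow> 'b pair_pre_digraph \<Rightarrow> ('a \<times> 'b) pair_pre_digraph" where
  "cartesian_product G H =
    \<lparr> pverts = pverts G \<times> pverts H,
      parcs = {((u, u'), (v, v')) | u u' v v'.
                 (u = v \<and> u \<in> pverts G \<and> (u', v') \<in> parcs H) \<or>
                 (u' = v' \<and> u' \<in> pverts H \<and> (u, v) \<in> parcs G)} \<rparr>"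

text \<open>
  The usual graph distance: the shortest-path distance of the library with every arc of
  cost 1 (see \<open>gdist_shortest_walk\<close> below).
\<close>
definition gdist :: "'a pair_pre_digraph \<Rightarrow> 'a \<Rightarrow> 'a \<Rightarrow> ereal" where
  "gdist G u v = wf_digraph.\<mu> (with_proj G) (\<lambda>_. 1) u v"

text \<open>
  A Cop strategy maps the distance vectors received so far (oldest first) to the next probe.
  The \<open>k\<close> vertices of a single probe are listed without repetition, since a probe is a set of
  \<open>k\<close> vertices; different turns may probe the same vertices.
\<close>
type_synonym 'a cop_strategy = "ereal list list \<Rightarrow> 'a list"

definition cop_strategy :: "'a pair_pre_digraph \<Rightarrow> nat \<Rightarrow> 'a cop_strategy \<Rightarrow> bool" where
  "cop_strategy G k \<sigma> \<longleftrightarrow>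
    (\<forall>h. length (\<sigma> h) = k \<and> distinct (\<sigma> h) \<and> set (\<sigma> h) \<subseteq> pverts G)"

text \<open>
  \<open>r t\<close> is the position of the Robber in turn \<open>t\<close>. Once the (deterministic) Cop strategy is
  fixed, the plays resulting from the strategies of the Robber, adaptive or not, are exactly
  these sequences.
\<close>
definition robber_play :: "'a pair_pre_digraph \<Rightarrow> (nat \<Rightarrow> 'a) \<Rightarrow> bool" where
  "robber_play G r \<longleftrightarrow>
    r 0 \<in> pverts G \<and> (\<forall>t. r (Suc t) = r t \<or> (r t, r (Suc t)) \<in> parcs G)"

text \<open>The distance vectors received in the first \<open>n\<close> turns.\<close>
primrec responses ::
    "'a pair_pre_digraph \<Rightarrow> 'a cop_strategy \<Rightarrow> (nat \<Rightarrow> 'a) \<Rightarrow> nat \<Rightarrow> ereal list list" where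
  "responses G \<sigma> r 0 = []"
| "responses G \<sigma> r (Suc n) =
    responses G \<sigma> r n @ [map (gdist G (r n)) (\<sigma> (responses G \<sigma> r n))]"

text \<open>
  In turn \<open>t\<close> the Cop can determine the current position of the Robber from everything received
  in turns \<open>0, \<dots>, t\<close>: all plays of the Robber consistent with it agree on that position.
\<close>
definition located ::
    "'a pair_pre_digraph \<Rightarrow> 'a cop_strategy \<Rightarrow> (nat \<Rightarrow> 'a) \<Rightarrow> nat \<Rightarrow> bool" where
  "located G \<sigma> r t \<longleftrightarrow>
    (\<forall>r'. robber_play G r' \<and> responses G \<sigma> r' (Suc t) = responses G \<sigma> r (Suc t)
          \<longrightarrow> r' t = r t)"

definition cop_wins :: "'a pair_pre_digraph \<Rightarrow> nat \<Rightarrow> bool" where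
  "cop_wins G k \<longleftrightarrow>
    (\<exists>\<sigma>. cop_strategy G k \<sigma> \<and> (\<forall>r. robber_play G r \<longrightarrow> (\<exists>t. located G \<sigma> r t)))"

definition localization_number :: "'a pair_pre_digraph \<Rightarrow> nat" (\<open>\<zeta>\<close>) where
  "\<zeta> G = (LEAST k. 0 < k \<and> cop_wins G k)"


lemma pair_graph_cartesian_product:
  assumes "pair_graph G" "pair_graph H"
  shows "pair_graph (cartesian_product G H)"
proof -
  interpret G: pair_graph G by fact
  interpret H: pair_graph H by fact
  let ?P = "cartesian_product G H"
  have sub: "parcs ?P \<subseteq> (pverts G \<times> pverts H) \<times> (pverts G \<times> pverts H)"
    using G.arc_fst_in_verts G.arc_snd_in_verts H.arc_fst_in_verts H.arc_snd_in_verts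
    by (fastforce simp: cartesian_product_def)
  have fin: "finite (parcs ?P)"
    using sub by (rule finite_subset) (simp add: G.pair_finite_verts H.pair_finite_verts)
  have sym: "(b, a) \<in> parcs ?P" if "(a, b) \<in> parcs ?P" for a b
    using that G.arcs_symmetric H.arcs_symmetric
    by (auto simp: cartesian_product_def)
  have irr: "fst e \<noteq> snd e" if "e \<in> parcs ?P" for e
    using that G.pair_no_loops H.pair_no_loops by (fastforce simp: cartesian_product_def)
  show ?thesis
  proof unfold_locales
    fix e assume "e \<in> parcs ?P"
    with sub have "e \<in> (pverts G \<times> pverts H) \<times> (pverts G \<times> pverts H)" by blast
    then show "fst e \<in> pverts ?P" "snd e \<in> pverts ?P"
      by (auto simp: cartesian_product_def)
  next
    show "finite (pverts ?P)" by (simp add: cartesian_product_def)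
  next
    show "symmetric (with_proj ?P)"
      using sym by (auto simp: symmetric_def sym_def)
  qed (use fin irr in auto)
qed

lemma gdist_shortest_walk:
  assumes "pair_graph G" "Digraph_Component.connected (with_proj G)"
    and "u \<in> pverts G" "v \<in> pverts G"
  obtains p where "pre_digraph.awalk (with_proj G) u p v" "gdist G u v = ereal (real (length p))"
    "\<And>q. pre_digraph.awalk (with_proj G) u q v \<Longrightarrow> length p \<le> length q"
proof -
  interpret pair_graph G by fact
  have cost: "awalk_cost (\<lambda>_. 1) p = real (length p)" for p :: "('a \<times> 'a) list"
    by (induct p) auto
  have "strongly_connected (with_proj G)"
    by (rule symmetric_connected_imp_strongly_connected[OF sym_arcs assms(2)])
  then have "u \<rightarrow>\<^sup>*\<^bsub>with_proj G\<^esub> v"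
    using assms(3,4) by (auto simp: strongly_connected_def)
  then obtain p0 where "awalk u p0 v" by (auto simp: reachable_awalk)
  then obtain p where p: "awalk u p v" and min: "\<And>q. awalk u q v \<Longrightarrow> length p \<le> length q"
    using ex_has_least_nat[of "\<lambda>p. awalk u p v" p0 length] by blast
  have "\<mu> (\<lambda>_. 1) u v = ereal (real (length p))"
    unfolding \<mu>_def cost
    by (rule INF_eqI) (use p min in auto)
  with p min show thesis by (intro that) (auto simp: gdist_def)
qed

lemma cop_wins_card:
  assumes "pair_graph G" "Digraph_Component.connected (with_proj G)"
  shows "0 < card (pverts G) \<and> cop_wins G (card (pverts G))"
proof
  interpret pair_graph G by fact
  show "0 < card (pverts G)"
    using assms(2) pair_finite_verts by (auto simp: card_gt_0_iff connected_conv)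
  obtain bs where bs: "set bs = pverts G" "distinct bs"
    using finite_distinct_list[OF pair_finite_verts] by blast
  have zero: "gdist G u v = 0 \<longleftrightarrow> u = v" if uv: "u \<in> pverts G" "v \<in> pverts G" for u v
  proof -
    obtain p where p: "awalk u p v" "gdist G u v = ereal (real (length p))"
      and min: "\<And>q. awalk u q v \<Longrightarrow> length p \<le> length q"
      using gdist_shortest_walk[OF assms uv] by metis
    have "u = v" if "p = []" using p(1) that by (simp add: awalk_Nil_iff)
    moreover have "p = []" if "u = v" using min[of "[]"] that uv by (simp add: awalk_Nil_iff)
    ultimately show ?thesis using p(2) by auto
  qed
  have "located G (\<lambda>_. bs) r 0" if r: "robber_play G r" for r
    unfolding located_def
  proof (intro allI impI, elim conjE)
    fix r' assume r': "robber_play G r'"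
      and "responses G (\<lambda>_. bs) r' (Suc 0) = responses G (\<lambda>_. bs) r (Suc 0)"
    moreover have "r 0 \<in> set bs" "r 0 \<in> pverts G" "r' 0 \<in> pverts G"
      using r r' bs by (auto simp: robber_play_def)
    ultimately have "gdist G (r' 0) (r 0) = gdist G (r 0) (r 0)" by simp
    moreover have "gdist G (r 0) (r 0) = 0"
      using zero[of "r 0" "r 0"] r by (simp add: robber_play_def)
    ultimately show "r' 0 = r 0"
      using zero[of "r' 0" "r 0"] r r' by (simp add: robber_play_def)
  qed
  moreover have "cop_strategy G (card (pverts G)) (\<lambda>_. bs)"
    using bs by (simp add: cop_strategy_def flip: distinct_card)
  ultimately show "cop_wins G (card (pverts G))" unfolding cop_wins_def by blast
qed

end

theory Submission
  imports Defs
begin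

text \<open>
  A Robber confined to a layer \<open>V(G) \<times> {w}\<close> is at distance
  \<open>d\<^sub>G(a, b) + d\<^sub>H(w, b')\<close> from a probe \<open>(b, b')\<close>, so a Cop playing on \<open>G\<close> can simulate a
  winning strategy on the product by probing the projections \<open>b\<close>. Projections of different
  probes may coincide; the probe is then filled up with arbitrary vertices. This is possible
  unless there are more cops than vertices of \<open>G\<close>, in which case the bound is trivial.
\<close>

section \<open>Walks and distances in the Cartesian product\<close>

lemma pverts_cartesian_product [simp]:
  "pverts (cartesian_product G H) = pverts G \<times> pverts H"
  by (simp add: cartesian_product_def)

lemma in_parcs_cartesian_product [simp]:
  "((u, u'), (v, v')) \<in> parcs (cartesian_product G H) \<longleftrightarrow>
    u = v \<and> u \<in> pverts G \<and> (u', v') \<in> parcs H \<or>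
    u' = v' \<and> u' \<in> pverts H \<and> (u, v) \<in> parcs G"
  by (auto simp: cartesian_product_def)

lemma awalk_cartesian_product_fst:
  assumes "pair_graph G" "pair_graph H"
    and "pre_digraph.awalk (with_proj G) u p v" "w \<in> pverts H"
  shows "pre_digraph.awalk (with_proj (cartesian_product G H))
    (u, w) (map (\<lambda>(a, b). ((a, w), (b, w))) p) (v, w)"
proof -
  interpret G: pair_graph G by fact
  interpret P: pair_graph "cartesian_product G H"
    by (rule pair_graph_cartesian_product) fact+
  show ?thesis
    using assms(3,4)
    by (induct p arbitrary: u)
      (auto simp: G.awalk_Nil_iff P.awalk_Nil_iff G.awalk_Cons_iff P.awalk_Cons_iff)
qed

lemma awalk_cartesian_product_snd:
  assumes "pair_graph G" "pair_graph H"
    and "pre_digraph.awalk (with_proj H) u p v" "w \<in> pverts G"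
  shows "pre_digraph.awalk (with_proj (cartesian_product G H))
    (w, u) (map (\<lambda>(a, b). ((w, a), (w, b))) p) (w, v)"
proof -
  interpret H: pair_graph H by fact
  interpret P: pair_graph "cartesian_product G H"
    by (rule pair_graph_cartesian_product) fact+
  show ?thesis
    using assms(3,4)
    by (induct p arbitrary: u)
      (auto simp: H.awalk_Nil_iff P.awalk_Nil_iff H.awalk_Cons_iff P.awalk_Cons_iff)
qed

text \<open>Walk along \<open>p\<close> in the layer with second coordinate \<open>u'\<close>, then
  along \<open>q\<close> in the layer with first coordinate \<open>v\<close>. This bounds product
  distances from above.\<close>

lemma awalk_cartesian_product_combine:
  assumes "pair_graph G" "pair_graph H"
    and p: "pre_digraph.awalk (with_proj G) u p v"
    and q: "pre_digraph.awalk (with_proj H) u' q v'"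
  obtains s where "pre_digraph.awalk (with_proj (cartesian_product G H)) (u, u') s (v, v')"
    and "length s = length p + length q"
proof -
  interpret G: pair_graph G by fact
  interpret H: pair_graph H by fact
  interpret P: pair_graph "cartesian_product G H"
    by (rule pair_graph_cartesian_product) fact+
  have "v \<in> pverts G" "u' \<in> pverts H"
    using G.awalk_last_in_verts[OF p] H.awalk_hd_in_verts[OF q] p q by auto
  then show thesis
    by (intro that[OF P.awalk_appendI[OF awalk_cartesian_product_fst[OF assms(1,2) p]
            awalk_cartesian_product_snd[OF assms(1,2) q]]]) auto
qed

text \<open>Every arc of the product changes exactly one coordinate, so it extends exactly one of
  the two projected walks. This bounds product distances from below.\<close>

lemma awalk_cartesian_product_split:
  assumes "pair_graph G" "pair_graph H"
    and "pre_digraph.awalk (with_proj (cartesian_product G H)) (u, u') s (v, v')"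
  shows "\<exists>p q. pre_digraph.awalk (with_proj G) u p v \<and> pre_digraph.awalk (with_proj H) u' q v' \<and>
    length s = length p + length q"
proof -
  interpret G: pair_graph G by fact
  interpret H: pair_graph H by fact
  interpret P: pair_graph "cartesian_product G H"
    by (rule pair_graph_cartesian_product) fact+
  show ?thesis
    using assms(3)
  proof (induct s arbitrary: u u')
    case Nil
    then have "G.awalk u [] v" "H.awalk u' [] v'"
      by (auto simp: P.awalk_Nil_iff G.awalk_Nil_iff H.awalk_Nil_iff)
    then show ?case by fastforce
  next
    case (Cons e s)
    then obtain x x' where e: "e = ((u, u'), (x, x'))" "e \<in> parcs (cartesian_product G H)"
      and s: "P.awalk (x, x') s (v, v')"
      by (cases e) (auto simp: P.awalk_Cons_iff)
    from Cons.hyps[OF s] obtain p q where pq: "G.awalk x p v" "H.awalk x' q v'"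
      "length s = length p + length q" by blast
    from e consider "u = x" "(u', x') \<in> parcs H" | "u' = x'" "(u, x) \<in> parcs G"
      by auto
    then show ?case
    proof cases
      case 1
      then have "H.awalk u' ((u', x') # q) v'" using pq by (simp add: H.awalk_Cons_iff)
      moreover have "G.awalk u p v" "length (e # s) = length p + length ((u', x') # q)"
        using 1 pq by auto
      ultimately show ?thesis by blast
    next
      case 2
      then have "G.awalk u ((u, x) # p) v" using pq by (simp add: G.awalk_Cons_iff)
      moreover have "H.awalk u' q v'" "length (e # s) = length ((u, x) # p) + length q"
        using 2 pq by auto
      ultimately show ?thesis by blast
    qed
  qed
qed

text \<open>Makes \<open>gdist_shortest_walk\<close> and \<open>cop_wins_card\<close> applicable to
  the product.\<close>

lemma connected_cartesian_product:
  assumes "pair_graph G" "Digraph_Component.connected (with_proj G)"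
    and "pair_graph H" "Digraph_Component.connected (with_proj H)"
  shows "Digraph_Component.connected (with_proj (cartesian_product G H))"
proof -
  interpret G: pair_graph G by fact
  interpret H: pair_graph H by fact
  interpret P: pair_graph "cartesian_product G H"
    by (rule pair_graph_cartesian_product) fact+
  have "x \<rightarrow>\<^sup>*\<^bsub>with_proj (cartesian_product G H)\<^esub> y"
    if "x \<in> pverts (cartesian_product G H)" "y \<in> pverts (cartesian_product G H)" for x y
  proof -
    have xy: "fst x \<in> pverts G" "fst y \<in> pverts G" "snd x \<in> pverts H" "snd y \<in> pverts H"
      using that by auto
    obtain p where p: "G.awalk (fst x) p (fst y)"
      using gdist_shortest_walk[OF assms(1,2) xy(1,2)] by metis
    obtain q where q: "H.awalk (snd x) q (snd y)"
      using gdist_shortest_walk[OF assms(3,4) xy(3,4)] by metis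
    obtain s where "P.awalk x s y"
      using awalk_cartesian_product_combine[OF assms(1,3) p q] by auto
    then show ?thesis by (auto simp: P.reachable_awalk)
  qed
  moreover have "pverts (cartesian_product G H) \<noteq> {}"
    using assms(2,4) by (auto simp: connected_conv)
  ultimately show ?thesis
    by (intro P.connectedI P.reachable_mk_symmetricI) auto
qed

lemma gdist_cartesian_product:
  assumes "pair_graph G" "Digraph_Component.connected (with_proj G)"
    and "pair_graph H" "Digraph_Component.connected (with_proj H)"
    and uv: "u \<in> pverts G" "v \<in> pverts G" and uv': "u' \<in> pverts H" "v' \<in> pverts H"
  shows "gdist (cartesian_product G H) (u, u') (v, v') = gdist G u v + gdist H u' v'"
proof -
  obtain p where p: "pre_digraph.awalk (with_proj G) u p v" "gdist G u v = ereal (real (length p))"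
    and p_min: "\<And>q. pre_digraph.awalk (with_proj G) u q v \<Longrightarrow> length p \<le> length q"
    using gdist_shortest_walk[OF assms(1,2) uv] by metis
  obtain q where q: "pre_digraph.awalk (with_proj H) u' q v'"
    "gdist H u' v' = ereal (real (length q))"
    and q_min: "\<And>p. pre_digraph.awalk (with_proj H) u' p v' \<Longrightarrow> length q \<le> length p"
    using gdist_shortest_walk[OF assms(3,4) uv'] by metis
  have "(u, u') \<in> pverts (cartesian_product G H)" "(v, v') \<in> pverts (cartesian_product G H)"
    using uv uv' by auto
  then obtain s where s: "pre_digraph.awalk (with_proj (cartesian_product G H)) (u, u') s (v, v')"
    "gdist (cartesian_product G H) (u, u') (v, v') = ereal (real (length s))"
    and s_min: "\<And>t. pre_digraph.awalk (with_proj (cartesian_product G H)) (u, u') t (v, v') \<Longrightarrow>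
      length s \<le> length t"
    using gdist_shortest_walk[OF pair_graph_cartesian_product[OF assms(1,3)]
        connected_cartesian_product[OF assms(1-4)]] by metis
  have "length s \<le> length p + length q"
    using awalk_cartesian_product_combine[OF assms(1,3) p(1) q(1)] s_min by metis
  moreover have "length p + length q \<le> length s"
    using awalk_cartesian_product_split[OF assms(1,3) s(1)] p_min q_min
    by (metis add_le_mono)
  ultimately show ?thesis using p(2) q(2) s(2) by simp
qed

section \<open>Simulating a Cop strategy on a smaller graph\<close>

lemma ex_distinct_list_superset:
  assumes "finite V" "A \<subseteq> V" "card A \<le> k" "k \<le> card V"
  obtains ys where "length ys = k" "distinct ys" "A \<subseteq> set ys" "set ys \<subseteq> V"
proof -
  obtain B where B: "A \<subseteq> B" "B \<subseteq> V" "card B = k"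
    using exists_subset_between[OF assms(3,4,2,1)] by blast
  moreover have "finite B" using B(2) assms(1) by (rule finite_subset)
  ultimately show thesis
    using that finite_distinct_list[of B] distinct_card by metis
qed

text \<open>Here \<open>\<sigma>\<close> is a strategy on the large graph, \<open>\<pi>\<close>
  projects its probe vertices to \<open>G\<close>, and \<open>pad\<close> extends the projected
  probe to an admissible one. The map \<open>\<phi> b\<close> turns a distance to
  \<open>\<pi> b\<close> in \<open>G\<close> into the distance to \<open>b\<close> that
  \<open>\<sigma>\<close> expects.\<close>

context
  fixes G :: "'a pair_pre_digraph" and \<sigma> :: "'p cop_strategy"
    and pad :: "'a list \<Rightarrow> 'a list" and \<pi> :: "'p \<Rightarrow> 'a" and \<phi> :: "'p \<Rightarrow> ereal \<Rightarrow> ereal"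
begin

text \<open>The history a Cop playing \<open>\<sigma>\<close> would see, computed from the history seen on \<open>G\<close>.\<close>
definition simulated_history :: "ereal list list \<Rightarrow> ereal list list" where
  "simulated_history h = foldl (\<lambda>h' ds. h' @
     [map (\<lambda>b. \<phi> b (the (map_of (zip (pad (map \<pi> (\<sigma> h'))) ds) (\<pi> b)))) (\<sigma> h')]) [] h"

definition simulated_strategy :: "'a cop_strategy" where
  "simulated_strategy h = pad (map \<pi> (\<sigma> (simulated_history h)))"

lemma simulated_history_Nil: "simulated_history [] = []"
  by (simp add: simulated_history_def)

text \<open>The fold has to spell out the padded probe, since \<open>simulated_strategy\<close> is
  itself defined from \<open>simulated_history\<close>; from here on that probe can be referred to
  by name.\<close>

lemma simulated_history_snoc:
  "simulated_history (h @ [ds]) = simulated_history h @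
    [map (\<lambda>b. \<phi> b (the (map_of (zip (simulated_strategy h) ds) (\<pi> b))))
      (\<sigma> (simulated_history h))]"
  by (simp add: simulated_history_def simulated_strategy_def)

text \<open>By induction on the turns: \<open>pad\<close> keeps every projection
  \<open>\<pi> b\<close> in the probe, so its distance can be looked up in the response, and
  \<open>dist\<close> converts it into the entry for \<open>b\<close>.\<close>

lemma responses_simulated:
  assumes pad: "\<And>h. set (map \<pi> (\<sigma> h)) \<subseteq> set (pad (map \<pi> (\<sigma> h)))"
    and dist: "\<And>t h b. b \<in> set (\<sigma> h) \<Longrightarrow> gdist P (f (r t)) b = \<phi> b (gdist G (r t) (\<pi> b))"
  shows "responses P \<sigma> (f \<circ> r) n = simulated_history (responses G simulated_strategy r n)"
proof (induct n)
  case 0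
  then show ?case by (simp add: simulated_history_Nil)
next
  case (Suc n)
  define h where "h = responses G simulated_strategy r n"
  \<comment> \<open>All entries with key \<open>y\<close> carry the same value \<open>g y\<close>,
    so the first match is the right one.\<close>
  have lookup: "the (map_of (zip ys (map g ys)) y) = g y" if "y \<in> set ys"
    for ys y and g :: "'a \<Rightarrow> ereal"
    using that by (simp add: map_of_zip_map)
  have "\<pi> b \<in> set (simulated_strategy h)" if "b \<in> set (\<sigma> (simulated_history h))" for b
    using pad[of "simulated_history h"] that by (auto simp: simulated_strategy_def)
  then have "map (gdist P (f (r n))) (\<sigma> (simulated_history h)) =
    map (\<lambda>b. \<phi> b (the (map_of (zip (simulated_strategy h)
      (map (gdist G (r n)) (simulated_strategy h))) (\<pi> b)))) (\<sigma> (simulated_history h))"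
    by (simp add: lookup dist)
  then show ?case
    using Suc by (simp add: simulated_history_snoc flip: h_def)
qed

end

text \<open>A Robber on \<open>G\<close> is treated as one on \<open>P\<close> through
  \<open>f\<close>. As \<open>\<sigma>\<close> beats all plays on \<open>P\<close>, it locates the
  lifted ones, and injectivity of \<open>f\<close> carries the location back to
  \<open>G\<close>.\<close>

lemma cop_wins_simulation:
  assumes wins: "cop_wins P k" and fin: "finite (pverts G)" and k: "k \<le> card (pverts G)"
    and wf: "\<And>u v. (u, v) \<in> parcs G \<Longrightarrow> v \<in> pverts G"
    and f_verts: "\<And>u. u \<in> pverts G \<Longrightarrow> f u \<in> pverts P"
    and f_arcs: "\<And>u v. (u, v) \<in> parcs G \<Longrightarrow> (f u, f v) \<in> parcs P"
    and f_inj: "inj f"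
    and \<pi>: "\<And>b. b \<in> pverts P \<Longrightarrow> \<pi> b \<in> pverts G"
    and dist: "\<And>u b. u \<in> pverts G \<Longrightarrow> b \<in> pverts P \<Longrightarrow> gdist P (f u) b = \<phi> b (gdist G u (\<pi> b))"
  shows "cop_wins G k"
proof -
  obtain \<sigma> where \<sigma>: "cop_strategy P k \<sigma>"
    and \<sigma>_wins: "\<And>r. robber_play P r \<Longrightarrow> \<exists>t. located P \<sigma> r t"
    using wins by (auto simp: cop_wins_def)
  \<comment> \<open>Coinciding projections leave at most \<open>k\<close> distinct vertices;
    \<open>k \<le> card (pverts G)\<close> provides room to fill up to exactly \<open>k\<close>.
    Stated for every \<open>xs\<close>, this yields \<open>pad\<close> by choice.\<close>
  have "\<exists>ys. set xs \<subseteq> pverts G \<and> length xs = k \<longrightarrow>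
      length ys = k \<and> distinct ys \<and> set xs \<subseteq> set ys \<and> set ys \<subseteq> pverts G" for xs
    using ex_distinct_list_superset[OF fin _ _ k, of "set xs"] card_length[of xs] by metis
  then obtain pad where pad: "\<And>xs. set xs \<subseteq> pverts G \<Longrightarrow> length xs = k \<Longrightarrow>
      length (pad xs) = k \<and> distinct (pad xs) \<and> set xs \<subseteq> set (pad xs) \<and> set (pad xs) \<subseteq> pverts G"
    by metis
  have \<sigma>_verts: "length (\<sigma> h) = k" "set (\<sigma> h) \<subseteq> pverts P" for h
    using \<sigma> by (auto simp: cop_strategy_def)
  then have "set (map \<pi> (\<sigma> h)) \<subseteq> pverts G" "length (map \<pi> (\<sigma> h)) = k" for h
    using \<pi> by auto
  note pad\<sigma> = pad[OF this]
  define \<tau> where "\<tau> = simulated_strategy \<sigma> pad \<pi> \<phi>"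
  have "cop_strategy G k \<tau>"
    using pad\<sigma> by (simp add: cop_strategy_def \<tau>_def simulated_strategy_def)
  moreover have "\<exists>t. located G \<tau> r t" if r: "robber_play G r" for r
  proof -
    have lift: "robber_play P (f \<circ> s)" if "robber_play G s" for s
      using that unfolding robber_play_def by (auto simp: f_verts) (metis f_arcs)
    have resp: "responses P \<sigma> (f \<circ> s) n = simulated_history \<sigma> pad \<pi> \<phi> (responses G \<tau> s n)"
      if s: "robber_play G s" for s n
    proof -
      \<comment> \<open>The distance formula \<open>dist\<close> is assumed only for vertices of
        \<open>G\<close>, so the whole play must stay there.\<close>
      have "s t \<in> pverts G" for t
      proof (induct t)
        case 0
        then show ?case using s by (simp add: robber_play_def)
      next
        case (Suc t)
        have "s (Suc t) = s t \<or> (s t, s (Suc t)) \<in> parcs G"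
          using s by (simp add: robber_play_def)
        with Suc show ?case using wf by metis
      qed
      then show ?thesis
        unfolding \<tau>_def using pad\<sigma> \<sigma>_verts dist
        by (intro responses_simulated) blast+
    qed
    obtain t where t: "located P \<sigma> (f \<circ> r) t" using \<sigma>_wins[OF lift[OF r]] by blast
    have "r' t = r t" if "robber_play G r'" "responses G \<tau> r' (Suc t) = responses G \<tau> r (Suc t)" for r'
    proof -
      \<comment> \<open>Both sides are the same function of the responses on \<open>G\<close>, so
        plays that \<open>\<tau>\<close> cannot tell apart lift to plays that
        \<open>\<sigma>\<close> cannot tell apart.\<close>
      have "responses P \<sigma> (f \<circ> r') (Suc t) = responses P \<sigma> (f \<circ> r) (Suc t)"
        using resp[OF that(1), of "Suc t"] resp[OF r, of "Suc t"] that(2) by metis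
      then have "(f \<circ> r') t = (f \<circ> r) t"
        using t lift[OF that(1)] unfolding located_def by blast
      then show ?thesis using f_inj by (simp add: inj_eq)
    qed
    then show ?thesis unfolding located_def by blast
  qed
  ultimately show ?thesis unfolding cop_wins_def by blast
qed

section \<open>Comparing localization numbers\<close>

text \<open>Probing all vertices wins at once, so \<open>\<zeta> G\<close> never exceeds the number
  of vertices. Hence a simulation is required only when \<open>k\<close> distinct vertices
  exist.\<close>

lemma localization_number_le_if_cop_wins:
  assumes "pair_graph G" "Digraph_Component.connected (with_proj G)" "0 < k"
    and "k \<le> card (pverts G) \<Longrightarrow> cop_wins G k"
  shows "\<zeta> G \<le> k"
proof (cases "k \<le> card (pverts G)")
  case True
  then show ?thesis using assms(3,4) by (simp add: localization_number_def Least_le)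
next
  case False
  have "\<zeta> G \<le> card (pverts G)"
    unfolding localization_number_def by (rule Least_le) (rule cop_wins_card[OF assms(1,2)])
  with False show ?thesis by simp
qed

theorem theorem3p4:
  fixes G :: "'a pair_pre_digraph" and H :: "'b pair_pre_digraph"
  assumes "pair_graph G" and "Digraph_Component.connected (with_proj G)"
    and "pair_graph H" and "Digraph_Component.connected (with_proj H)"
  shows "\<zeta> (cartesian_product G H) \<ge> max (\<zeta> G) (\<zeta> H)"
proof -
  interpret G: pair_graph G by fact
  interpret H: pair_graph H by fact
  have wf_G: "v \<in> pverts G" if "(u, v) \<in> parcs G" for u v
    using G.arc_snd_in_verts[OF that] by simp
  have wf_H: "v \<in> pverts H" if "(u, v) \<in> parcs H" for u v
    using H.arc_snd_in_verts[OF that] by simp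
  let ?P = "cartesian_product G H"
  \<comment> \<open>The least value is attained because the number of vertices of the product is an
    admissible number of cops.\<close>
  have "0 < \<zeta> ?P \<and> cop_wins ?P (\<zeta> ?P)"
    unfolding localization_number_def
    by (rule LeastI) (rule cop_wins_card[OF pair_graph_cartesian_product[OF assms(1,3)]
          connected_cartesian_product[OF assms]])
  then have pos: "0 < \<zeta> ?P" and wins: "cop_wins ?P (\<zeta> ?P)" by auto
  obtain g h where g: "g \<in> pverts G" and h: "h \<in> pverts H"
    using assms(2,4) by (auto simp: connected_conv)
  have "\<zeta> G \<le> \<zeta> ?P"
  proof (rule localization_number_le_if_cop_wins[OF assms(1,2) pos])
    assume "\<zeta> ?P \<le> card (pverts G)"
    \<comment> \<open>The Robber is confined to the layer of the fixed vertex \<open>h\<close>; the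
      correction \<open>gdist H h (snd b)\<close> depends only on the probe, so the Cop knows
      it.\<close>
    then show "cop_wins G (\<zeta> ?P)"
      by (rule cop_wins_simulation[where f = "\<lambda>u. (u, h)" and \<pi> = fst
            and \<phi> = "\<lambda>b d. d + gdist H h (snd b)", OF wins G.pair_finite_verts])
        (use h wf_G in \<open>auto simp: inj_def gdist_cartesian_product[OF assms]\<close>)
  qed
  moreover have "\<zeta> H \<le> \<zeta> ?P"
  proof (rule localization_number_le_if_cop_wins[OF assms(3,4) pos])
    assume "\<zeta> ?P \<le> card (pverts H)"
    then show "cop_wins H (\<zeta> ?P)"
      by (rule cop_wins_simulation[where f = "\<lambda>u. (g, u)" and \<pi> = snd
            and \<phi> = "\<lambda>b d. gdist G g (fst b) + d", OF wins H.pair_finite_verts])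
        (use g wf_H in \<open>auto simp: inj_def gdist_cartesian_product[OF assms]\<close>)
  qed
  ultimately show ?thesis by simp
qed

end
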